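(* Let $\tau>0$ and let $f:\mathbb{R}^n\times\mathbb{R}^n\to\mathbb{R}^n$ be locally Lipschitz with $f(0,0)=0$. Consider the time-delay system $\dot x(t)=f(x(t),x(t-\tau))$, $x(\theta)=\varphi(\theta)$ for $\theta\in[-\tau,0]$, with $\varphi\in\mathcal{C}$. Assume that there exist positive numbers $\lambda_1,\lambda_2,\lambda_3,r_1,r_2,k$ and a continuously differentiable functional $V:\mathcal{C}\to\mathbb{R}_+$ such that, along every solution of the system, $$\lambda_1\|x(t)\|^{r_1}\le V(x_t)\le\lambda_2\|x_t\|_\infty^{r_2},$$ $$\dot V(x_t)+\lambda_3V^{1+k}(x_t)\le 0 .$$ Then the zero solution of the system is globally rationally stable.
   Context: $\mathcal{C}$ is the Banach space of continuous functions $[-\tau,0]\to\mathbb{R}^n$ with norm $\|\varphi\|_\infty=\max_{\theta\in[-\tau,0]}\|\varphi(\theta)\|$, where $\|\cdot\|$ is the Euclidean norm. For a solution $x$, the segment $x_t\in\mathcal{C}$ is $x_t(\theta)=x(t+\theta)$, $\theta\in[-\tau,0]$, so $x_0=\varphi$. Conditions on $V(x_t)$ and $\dot V(x_t)$ are required for every initial function $\varphi\in\mathcal{C}$ and all $t\ge0$ at which the solution exists. The derivative of $V$ along solutions is $\dot V(x_t)=\lim_{h\to0}\frac1h\big(V(x_{t+h})-V(x_t)\big)$. $V^{1+k}(x_t)$ means $(V(x_t))^{1+k}$. Stability notions for the zero solution: - Stable: for every $\varepsilon>0$ there is $\delta>0$ such that $\|\varphi\|_\infty<\delta$ implies $\|x(t)\|<\varepsilon$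 for all $t\ge0$. - Globally rationally stable: it is stable, $\delta$ can be chosen arbitrarily large for sufficiently large $\varepsilon$, and for every $\sigma>0$ there exist positive numbers $M,\kappa,e$ with $e\le1$ such that $$\|\varphi\|_\infty<\sigma\ \Rightarrow\ \|x(t)\|\le\frac{M\|\varphi\|_\infty^{e}}{(1+\|\varphi\|_\infty^{\kappa}t)^{1/\kappa}}\quad\text{for all }t\ge0.$$ *)

theory Defs
  imports "HOL-Analysis.Analysis"
begin

section \<open>The phase space of continuous functions on [-\<tau>, 0]\<close>

text \<open>
  The interval depends on the real parameter \<tau>, so the Banach space of continuous functions on
  [-\<tau>, 0] cannot be a type of its own. A continuous function on [-\<tau>, 0] is
  represented by its extension to the real line that is constant on both sides of the interval.
  These extensions form a closed subspace of the bounded continuous functions, and the norm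
  inherited from there is the maximum norm over [-\<tau>, 0] (see the lemmas below).
\<close>

definition phase_space :: "real \<Rightarrow> (real \<Rightarrow>\<^sub>C (real ^ 'n)) set" where
  "phase_space \<tau> = {\<phi> :: real \<Rightarrow>\<^sub>C (real ^ 'n). \<forall>\<theta>. \<phi> \<theta> = \<phi> (clamp (- \<tau>) 0 \<theta>)}"

text \<open>The segment of \<open>x\<close> at time \<open>t\<close>, that is \<open>\<theta> \<mapsto> x (t + \<theta>)\<close> on [-\<tau>, 0].
  It is meaningful when \<open>x\<close> is continuous on [t - \<tau>, t].\<close>

definition segment :: "real \<Rightarrow> (real \<Rightarrow> real ^ 'n) \<Rightarrow> real \<Rightarrow> (real \<Rightarrow>\<^sub>C (real ^ 'n))" where
  "segment \<tau> x t = Bcontfun (ext_cont (\<lambda>\<theta>. x (t + \<theta>)) (- \<tau>) 0)"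

lemma segment_clamp:
  fixes x :: "real \<Rightarrow> real ^ 'n"
  assumes "continuous_on {t - \<tau>..t} x"
  shows "segment \<tau> x t \<theta> = x (t + clamp (- \<tau>) 0 \<theta>)"
proof -
  have "continuous_on {- \<tau>..0} (\<lambda>\<theta>. x (t + \<theta>))"
    by (rule continuous_on_compose2[OF assms]) (auto intro!: continuous_intros)
  then have c: "continuous_on (cbox (- \<tau>) 0) (\<lambda>\<theta>. x (t + \<theta>))"
    by simp
  obtain g :: "real \<Rightarrow>\<^sub>C (real ^ 'n)" where g: "\<And>\<theta>. g \<theta> = x (t + clamp (- \<tau>) 0 \<theta>)"
    using continuous_on_cbox_bcontfunE[OF c] by metis
  then have "ext_cont (\<lambda>\<theta>. x (t + \<theta>)) (- \<tau>) 0 = apply_bcontfun g"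
    by (auto simp: ext_cont_def)
  then show ?thesis
    by (simp add: segment_def apply_bcontfun_inverse g)
qed

lemma segment_apply:
  assumes "continuous_on {t - \<tau>..t} x" "\<theta> \<in> {- \<tau>..0}"
  shows "segment \<tau> x t \<theta> = x (t + \<theta>)"
  using assms by (simp add: segment_clamp)

lemma segment_in_phase_space:
  assumes "\<tau> > 0" "continuous_on {t - \<tau>..t} x"
  shows "segment \<tau> x t \<in> phase_space \<tau>"
proof -
  have "clamp (- \<tau>) 0 \<theta> \<in> cbox (- \<tau>) 0" for \<theta> :: real
    using assms(1) by (intro clamp_in_interval) auto
  then show ?thesis
    using assms(2) by (simp add: phase_space_def segment_clamp)
qed

lemma norm_phase_space:
  assumes "\<tau> > 0" "\<phi> \<in> phase_space \<tau>"
  shows "norm \<phi> = (SUP \<theta>\<in>{- \<tau>..0}. norm (\<phi> \<theta>))"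
proof (rule antisym)
  have "compact ((\<lambda>\<theta>. norm (\<phi> \<theta>)) ` {- \<tau>..0})"
    by (intro compact_continuous_image continuous_intros) auto
  then have b: "bdd_above ((\<lambda>\<theta>. norm (\<phi> \<theta>)) ` {- \<tau>..0})"
    by (intro bounded_imp_bdd_above compact_imp_bounded)
  show "norm \<phi> \<le> (SUP \<theta>\<in>{- \<tau>..0}. norm (\<phi> \<theta>))"
  proof (rule norm_bound)
    fix \<theta>
    have "clamp (- \<tau>) 0 \<theta> \<in> cbox (- \<tau>) 0"
      using assms(1) by (intro clamp_in_interval) auto
    then have "norm (\<phi> (clamp (- \<tau>) 0 \<theta>)) \<le> (SUP \<theta>\<in>{- \<tau>..0}. norm (\<phi> \<theta>))"
      by (intro cSUP_upper[OF _ b]) simp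
    moreover have "\<phi> \<theta> = \<phi> (clamp (- \<tau>) 0 \<theta>)"
      using assms(2) by (simp only: phase_space_def mem_Collect_eq)
    ultimately show "norm (\<phi> \<theta>) \<le> (SUP \<theta>\<in>{- \<tau>..0}. norm (\<phi> \<theta>))"
      by simp
  qed
  show "(SUP \<theta>\<in>{- \<tau>..0}. norm (\<phi> \<theta>)) \<le> norm \<phi>"
    using assms(1) by (intro cSUP_least norm_bounded) auto
qed


section \<open>Solutions\<close>

text \<open>\<open>x\<close> solves the delay equation with initial function \<open>\<phi>\<close> on [-\<tau>, T), where \<open>T\<close> may be
  infinite. The derivative at time 0 is the right derivative; since [0, T) is open in
  [0, \<infinity>), the derivative at \<open>t > 0\<close> is the usual one. Values of \<open>x\<close> outside [-\<tau>, T) are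
  irrelevant.\<close>

definition dde_solution ::
  "((real ^ 'n) \<times> (real ^ 'n) \<Rightarrow> real ^ 'n) \<Rightarrow> real \<Rightarrow> (real \<Rightarrow>\<^sub>C (real ^ 'n)) \<Rightarrow>
    (real \<Rightarrow> real ^ 'n) \<Rightarrow> ereal \<Rightarrow> bool" where
  "dde_solution f \<tau> \<phi> x T \<longleftrightarrow>
     0 < T \<and>
     continuous_on {t. - \<tau> \<le> t \<and> ereal t < T} x \<and>
     (\<forall>\<theta>\<in>{- \<tau>..0}. x \<theta> = \<phi> \<theta>) \<and>
     (\<forall>t\<ge>0. ereal t < T \<longrightarrow>
        (x has_vector_derivative f (x t, x (t - \<tau>))) (at t within {0..}))"

text \<open>Assertions about \<open>x(t)\<close> for all \<open>t \<ge> 0\<close> include that the solution exists for all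
  \<open>t \<ge> 0\<close>.\<close>

definition globally_satisfies ::
  "((real ^ 'n) \<times> (real ^ 'n) \<Rightarrow> real ^ 'n) \<Rightarrow> real \<Rightarrow> (real \<Rightarrow>\<^sub>C (real ^ 'n)) \<Rightarrow>
    (real \<Rightarrow> (real ^ 'n) \<Rightarrow> bool) \<Rightarrow> bool" where
  "globally_satisfies f \<tau> \<phi> P \<longleftrightarrow>
     (\<exists>x. dde_solution f \<tau> \<phi> x \<infinity>) \<and>
     (\<forall>x. dde_solution f \<tau> \<phi> x \<infinity> \<longrightarrow> (\<forall>t\<ge>0. P t (x t)))"


section \<open>Functionals on the phase space\<close>

text \<open>Continuous Frechet differentiability on the phase space. The derivative is given as a
  functional on all bounded continuous functions; only its restriction to the phase space is
  determined, and extending by the norm-one projection given by clamping shows that this is the same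
  as a continuous map from the phase space to its dual.\<close>

definition continuously_differentiable ::
  "real \<Rightarrow> ((real \<Rightarrow>\<^sub>C (real ^ 'n)) \<Rightarrow> real) \<Rightarrow> bool" where
  "continuously_differentiable \<tau> V \<longleftrightarrow>
     (\<exists>V' :: (real \<Rightarrow>\<^sub>C (real ^ 'n)) \<Rightarrow> ((real \<Rightarrow>\<^sub>C (real ^ 'n)) \<Rightarrow>\<^sub>L real).
        (\<forall>\<phi>\<in>phase_space \<tau>. (V has_derivative V' \<phi>) (at \<phi> within phase_space \<tau>)) \<and>
        continuous_on (phase_space \<tau>) V')"

text \<open>The limit exists and equals \<open>D\<close>. It is taken over those \<open>h\<close> with \<open>t + h \<ge> 0\<close>: it is two-sided
  for \<open>t > 0\<close>, and at \<open>t = 0\<close>, where segments at negative times are not defined, it is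
  the limit from the right.\<close>

definition has_derivative_along ::
  "((real \<Rightarrow>\<^sub>C (real ^ 'n)) \<Rightarrow> real) \<Rightarrow> real \<Rightarrow> (real \<Rightarrow> real ^ 'n) \<Rightarrow> real \<Rightarrow> real \<Rightarrow> bool" where
  "has_derivative_along V \<tau> x t D \<longleftrightarrow>
     ((\<lambda>h. (1 / h) * (V (segment \<tau> x (t + h)) - V (segment \<tau> x t))) \<longlongrightarrow> D) (at 0 within {- t..})"


section \<open>Stability of the zero solution\<close>

definition stable_bound ::
  "((real ^ 'n) \<times> (real ^ 'n) \<Rightarrow> real ^ 'n) \<Rightarrow> real \<Rightarrow> real \<Rightarrow> real \<Rightarrow> bool" where
  "stable_bound f \<tau> \<epsilon> \<delta> \<longleftrightarrow>
     (\<forall>\<phi>\<in>phase_space \<tau>. norm \<phi> < \<delta> \<longrightarrow> globally_satisfies f \<tau> \<phi> (\<lambda>t y. norm y < \<epsilon>))"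

definition zero_stable :: "((real ^ 'n) \<times> (real ^ 'n) \<Rightarrow> real ^ 'n) \<Rightarrow> real \<Rightarrow> bool" where
  "zero_stable f \<tau> \<longleftrightarrow> (\<forall>\<epsilon>>0. \<exists>\<delta>>0. stable_bound f \<tau> \<epsilon> \<delta>)"

definition globally_rationally_stable ::
  "((real ^ 'n) \<times> (real ^ 'n) \<Rightarrow> real ^ 'n) \<Rightarrow> real \<Rightarrow> bool" where
  "globally_rationally_stable f \<tau> \<longleftrightarrow>
     zero_stable f \<tau> \<and>
     (\<forall>\<Delta>. \<exists>\<epsilon>\<^sub>0>0. \<forall>\<epsilon>\<ge>\<epsilon>\<^sub>0. \<exists>\<delta>\<ge>\<Delta>. stable_bound f \<tau> \<epsilon> \<delta>) \<and>
     (\<forall>\<sigma>>0. \<exists>M>0. \<exists>\<kappa>>0. \<exists>e>0. e \<le> 1 \<and>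
        (\<forall>\<phi>\<in>phase_space \<tau>. norm \<phi> < \<sigma> \<longrightarrow>
           globally_satisfies f \<tau> \<phi>
             (\<lambda>t y. norm y \<le> M * norm \<phi> powr e / (1 + norm \<phi> powr \<kappa> * t) powr (1 / \<kappa>))))"

end

theory Submission
  imports Defs
begin

text \<open>
  Along a solution, \<open>v t = V (segment \<tau> x t)\<close> satisfies \<open>v' \<le> - lam\<^sub>3 * v powr (1 + k)\<close>, so that
  \<open>v powr (- k)\<close> grows at least at the rate \<open>k * lam\<^sub>3\<close>; with the two bounds on \<open>V\<close> this gives a
  rational decay of \<open>x\<close>, and in particular an a priori bound that depends only on the
  norm of the initial function. Global existence follows from that bound: replacing \<open>f\<close> outside a large
  ball by its composition with the metric projection makes it bounded and globally Lipschitz, the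
  truncated equation has a global solution by the contraction principle, and the a priori
  bound keeps this solution inside the ball, where both equations agree.
\<close>

section \<open>Global existence: contraction, then truncation\<close>

lemma integral_has_vector_derivative_atLeast:
  fixes g :: "real \<Rightarrow> 'a::banach"
  assumes "continuous_on {a..} g" "a \<le> t"
  shows "((\<lambda>u. integral {a..u} g) has_vector_derivative g t) (at t within {a..})"
proof -
  have "((\<lambda>u. integral {a..u} g) has_vector_derivative g t) (at t within {a..t + 1})"
    using assms by (intro integral_has_vector_derivative) (auto intro: continuous_on_subset)
  moreover have "at t within {a..t + 1} = at t within {a..}"
    using assms(2) by (intro at_within_nhd[of _ "{..<t + 1}"]) auto
  ultimately show ?thesis
    by simp
qed

text \<open>The integrated equation becomes a fixed point problem in the complete space of bounded
  continuous functions on the line. The bound \<open>B\<close> makes the integral term grow at most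
  linearly in time, which the exponential weight absorbs.\<close>

lemma lipschitz_dde_solution_exists:
  fixes F :: "(real ^ 'n) \<times> (real ^ 'n) \<Rightarrow> real ^ 'n"
  assumes \<tau>: "\<tau> > 0" and L: "L-lipschitz_on UNIV F" and B: "\<And>p. norm (F p) \<le> B"
  shows "\<exists>x. dde_solution F \<tau> \<phi> x \<infinity>"
proof -
  \<comment> \<open>The unknown is the rescaled function \<open>exp (- lam * max t 0) *\<^sub>R x t\<close> on the whole line: with this weight
    the Picard operator is a contraction without any restriction to short time intervals.\<close>
  define lam where "lam = 4 * (L + 1)"
  have L0: "L \<ge> 0" using L by (rule lipschitz_on_nonneg)
  then have lam: "lam \<ge> 1" by (simp add: lam_def)
  have B0: "B \<ge> 0" using B[of 0] norm_ge_zero order_trans by blast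
  define y where "y z s = exp (lam * max s 0) *\<^sub>R apply_bcontfun z s"
    for z :: "real \<Rightarrow>\<^sub>C (real ^ 'n)" and s :: real
  define G where "G z s = F (y z s, y z (s - \<tau>))" for z s
  \<comment> \<open>\<open>min\<close> and \<open>max\<close> merge history and integral equation
    into one formula: for \<open>t \<le> 0\<close> the integral runs over a single point and
    vanishes, for \<open>t \<ge> 0\<close> the first term stays at \<open>\<phi> 0\<close>.\<close>
  define P where "P z t = \<phi> (min t 0) + integral {0..max t 0} (G z)" for z t
  have Fc: "continuous_on UNIV F"
    using L by (rule lipschitz_on_continuous_on)
  have yc: "continuous_on UNIV (y z)" for z
    unfolding y_def by (intro continuous_intros) (auto intro: continuous_on_apply_bcontfun)
  have Gc: "continuous_on A (G z)" for z A
    unfolding G_def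
    by (rule continuous_on_compose2[OF Fc])
       (auto intro!: continuous_intros continuous_on_compose2[OF yc])
  have Gi: "G z integrable_on {a..b}" for z a b
    by (intro integrable_continuous_real Gc)
  have Gd: "((\<lambda>u. integral {0..u} (G z)) has_vector_derivative G z t) (at t within {0..})"
    if "t \<ge> 0" for z t
    using Gc that by (rule integral_has_vector_derivative_atLeast)
  have Ic: "continuous_on {0..} (\<lambda>u. integral {0..u} (G z))" for z
    by (rule continuous_on_vector_derivative) (auto intro: Gd)
  have Pc: "continuous_on UNIV (P z)" for z
    unfolding P_def
    by (intro continuous_intros continuous_on_compose2[OF Ic]
        continuous_on_compose2[OF continuous_on_apply_bcontfun[of UNIV \<phi>]]) auto
  have Pb: "norm (exp (- lam * max t 0) *\<^sub>R P z t) \<le> norm \<phi> + B" for z t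
  proof -
    define m where "m = max t 0"
    have m: "m \<ge> 0" by (simp add: m_def)
    have "norm (integral {0..m} (G z)) \<le> integral {0..m} (\<lambda>_. B)"
      by (intro integral_norm_bound_integral Gi) (auto simp: G_def B)
    then have "norm (P z t) \<le> norm \<phi> + B * m"
      using m norm_bounded[of \<phi> "min t 0"] unfolding P_def m_def[symmetric]
      by (intro order_trans[OF norm_triangle_ineq] add_mono) (auto simp: mult.commute)
    also have "\<dots> \<le> exp (lam * m) * (norm \<phi> + B)"
    proof -
      have "m \<le> lam * m" using mult_right_mono[OF lam m] by simp
      then have "1 \<le> exp (lam * m)" "m \<le> exp (lam * m)"
        using exp_ge_add_one_self[of "lam * m"] m by linarith+
      then have "1 * norm \<phi> \<le> exp (lam * m) * norm \<phi>" "m * B \<le> exp (lam * m) * B"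
        using B0 by (intro mult_right_mono; simp)+
      then show ?thesis by (simp add: algebra_simps)
    qed
    finally show ?thesis
      by (simp add: m_def[symmetric] exp_minus field_simps)
  qed
  define \<Phi> where "\<Phi> z = Bcontfun (\<lambda>t. exp (- lam * max t 0) *\<^sub>R P z t)" for z
  have \<Phi>: "\<Phi> z t = exp (- lam * max t 0) *\<^sub>R P z t" for z t
  proof -
    have "(\<lambda>t. exp (- lam * max t 0) *\<^sub>R P z t) \<in> bcontfun"
      by (rule bcontfun_normI[OF _ Pb]) (intro continuous_intros Pc)
    then show ?thesis by (simp only: \<Phi>_def Bcontfun_inverse)
  qed
  \<comment> \<open>The slack \<open>s \<le> s'\<close> allows the value at the delayed time
    \<open>s - \<tau>\<close> to be estimated with the weight at \<open>s\<close>.\<close>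
  have ydist: "dist (y z s) (y w s) \<le> exp (lam * max s' 0) * dist z w" if "s \<le> s'" for z w s s'
  proof -
    have "dist (y z s) (y w s) = exp (lam * max s 0) * dist (z s) (w s)"
      by (simp add: y_def dist_norm flip: scaleR_diff_right)
    also have "\<dots> \<le> exp (lam * max s' 0) * dist z w"
      using that lam by (intro mult_mono dist_bounded) (auto intro!: mult_left_mono)
    finally show ?thesis .
  qed
  have contr: "dist (\<Phi> z) (\<Phi> w) \<le> 1 / 2 * dist z w" for z w
  proof (rule dist_bound)
    fix t :: real
    define m where "m = max t 0"
    have m: "m \<ge> 0" by (simp add: m_def)
    \<comment> \<open>The factor 2 counts the two arguments of \<open>F\<close>, the current and the
      delayed value.\<close>
    define c where "c = 2 * L * dist z w"
    have c: "c \<ge> 0" using L0 by (simp add: c_def)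
    have Gdist: "norm (G z s - G w s) \<le> c * exp (lam * s)" if "s \<in> {0..m}" for s
    proof -
      have "norm (G z s - G w s) \<le> L * dist (y z s, y z (s - \<tau>)) (y w s, y w (s - \<tau>))"
        unfolding G_def dist_norm[symmetric] using L by (rule lipschitz_onD) auto
      also have "\<dots> \<le> L * (dist (y z s) (y w s) + dist (y z (s - \<tau>)) (y w (s - \<tau>)))"
        using L0 by (intro mult_left_mono) (auto simp: dist_Pair_Pair intro: sqrt_sum_squares_le_sum)
      also have "\<dots> \<le> L * (exp (lam * max s 0) * dist z w + exp (lam * max s 0) * dist z w)"
        using L0 \<tau> by (intro mult_left_mono add_mono ydist) auto
      finally show ?thesis using that by (simp add: c_def algebra_simps)
    qed
    \<comment> \<open>Integrating the weight gains a factor \<open>1 / lam\<close>, and the choice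
      \<open>lam = 4 * (L + 1)\<close> gives \<open>2 * L / lam \<le> 1 / 2\<close>.\<close>
    have I: "((\<lambda>s. c * exp (lam * s)) has_integral
        (c * exp (lam * m) / lam - c * exp (lam * 0) / lam)) {0..m}"
      using m lam
      by (intro fundamental_theorem_of_calculus)
         (auto intro!: derivative_eq_intros simp flip: has_real_derivative_iff_has_vector_derivative)
    have "norm (integral {0..m} (G z) - integral {0..m} (G w)) = norm (integral {0..m} (\<lambda>s. G z s - G w s))"
      by (simp add: integral_diff Gi)
    also have "\<dots> \<le> integral {0..m} (\<lambda>s. c * exp (lam * s))"
      using I by (intro integral_norm_bound_integral integrable_diff Gi Gdist) auto
    also have "\<dots> \<le> c / lam * exp (lam * m)"
      unfolding integral_unique[OF I] using lam c by simp
    also have "c / lam \<le> 1 / 2 * dist z w"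
      using L0 by (simp add: c_def lam_def field_simps)
    finally have *: "norm (integral {0..m} (G z) - integral {0..m} (G w)) \<le> 1 / 2 * dist z w * exp (lam * m)"
      by simp
    have "dist (\<Phi> z t) (\<Phi> w t) = exp (- lam * m) * norm (integral {0..m} (G z) - integral {0..m} (G w))"
      by (simp add: \<Phi> P_def m_def dist_norm flip: scaleR_diff_right)
    also have "\<dots> \<le> exp (- lam * m) * (1 / 2 * dist z w * exp (lam * m))"
      by (intro mult_left_mono *) simp
    also have "\<dots> = 1 / 2 * dist z w"
      by (simp add: exp_minus field_simps)
    finally show "dist (\<Phi> z t) (\<Phi> w t) \<le> 1 / 2 * dist z w" .
  qed
  obtain z where "\<Phi> z = z"
    using banach_fix_type[of "1 / 2" \<Phi>] contr by auto
  then have yP: "y z t = P z t" for t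
    using \<Phi>[of z t] by (simp add: y_def exp_minus)
  have "dde_solution F \<tau> \<phi> (y z) \<infinity>"
    unfolding dde_solution_def
  proof (intro conjI ballI allI impI)
    show "continuous_on {t. - \<tau> \<le> t \<and> ereal t < \<infinity>} (y z)"
      using yc by (rule continuous_on_subset) simp
    show "y z \<theta> = \<phi> \<theta>" if "\<theta> \<in> {- \<tau>..0}" for \<theta>
      using that by (simp add: yP P_def)
    show "(y z has_vector_derivative F (y z t, y z (t - \<tau>))) (at t within {0..})" if "0 \<le> t" for t
    proof (rule has_vector_derivative_transform[rotated 2])
      show "((\<lambda>u. \<phi> 0 + integral {0..u} (G z)) has_vector_derivative F (y z t, y z (t - \<tau>))) (at t within {0..})"
        using Gd[OF that, of z] unfolding G_def
        by (auto intro!: derivative_eq_intros)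
    qed (use that in \<open>auto simp: yP P_def\<close>)
  qed simp
  then show ?thesis by blast
qed

text \<open>The gap \<open>r < R\<close> excludes a first time at which the truncated solution
  reaches norm \<open>R\<close>: up to that time it solves the original equation, so the bound
  \<open>r\<close> holds before it and, by continuity, also at it. The a priori bound is required on
  finite intervals because it is applied before global existence is known.\<close>

lemma apriori_bound_imp_global_dde_solution:
  fixes f :: "(real ^ 'n) \<times> (real ^ 'n) \<Rightarrow> real ^ 'n"
  assumes \<tau>: "\<tau> > 0" and lip: "local_lipschitz (UNIV :: real set) UNIV (\<lambda>_. f)"
    and \<phi>: "norm \<phi> < R"
    and r: "r < R" "\<And>x T t. \<lbrakk>dde_solution f \<tau> \<phi> x T; 0 \<le> t; ereal t < T\<rbrakk> \<Longrightarrow> norm (x t) \<le> r"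
  shows "\<exists>x. dde_solution f \<tau> \<phi> x \<infinity>"
proof -
  define c where "c = closest_point (cball (0 :: real ^ 'n) R)"
  have R: "R > 0" using \<phi> norm_ge_zero[of \<phi>] by linarith
  have c_in: "c a \<in> cball 0 R" for a
    unfolding c_def using R by (intro closest_point_in_set) auto
  have c_id: "c a = a" if "norm a \<le> R" for a
    unfolding c_def using that by (intro closest_point_self) auto
  have c_lip: "dist (c a) (c b) \<le> dist a b" for a b
    unfolding c_def using R by (intro closest_point_lipschitz) auto
  define F where "F p = f (c (fst p), c (snd p))" for p
  define K where "K = cball (0 :: real ^ 'n) R \<times> cball (0 :: real ^ 'n) R"
  have K: "compact K" unfolding K_def by (intro compact_Times compact_cball)
  \<comment> \<open>Compactness of \<open>K\<close> yields a single Lipschitz constant for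
    \<open>f\<close> on \<open>K\<close>; composing with the nonexpansive projection
    \<open>c\<close> keeps it on the whole space.\<close>
  have "local_lipschitz {0 :: real} K (\<lambda>_. f)"
    by (rule local_lipschitz_subset[OF lip]) auto
  then obtain L where "\<And>t. t \<in> {0 :: real} \<Longrightarrow> L-lipschitz_on K f"
    using local_lipschitz_compact_implies_lipschitz[OF _ K, of "{0 :: real}" "\<lambda>_. f"] by auto
  then have L: "L-lipschitz_on K f" by auto
  have "(L * 1)-lipschitz_on UNIV (\<lambda>p. f (c (fst p), c (snd p)))"
  proof (rule lipschitz_on_compose2[where g = f and f = "\<lambda>p. (c (fst p), c (snd p))"])
    show "1-lipschitz_on UNIV (\<lambda>p. (c (fst p), c (snd p)))"
      by (rule lipschitz_onI)
         (auto simp: dist_Pair_Pair dist_prod_def intro!: real_sqrt_le_mono add_mono power_mono c_lip)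
    show "L-lipschitz_on ((\<lambda>p. (c (fst p), c (snd p))) ` UNIV) f"
      using L by (rule lipschitz_on_subset) (use c_in in \<open>auto simp: K_def\<close>)
  qed
  then have F_lip: "L-lipschitz_on UNIV F" by (simp add: F_def[abs_def])
  have "bounded (f ` K)"
    by (intro compact_imp_bounded compact_continuous_image lipschitz_on_continuous_on[OF L] K)
  then obtain B where B: "\<And>p. p \<in> K \<Longrightarrow> norm (f p) \<le> B"
    by (auto simp: bounded_iff)
  have "norm (F p) \<le> B" for p
    unfolding F_def by (rule B) (use c_in in \<open>auto simp: K_def\<close>)
  from lipschitz_dde_solution_exists[OF \<tau> F_lip this]
  obtain x where x: "dde_solution F \<tau> \<phi> x \<infinity>" by auto
  then have xc: "continuous_on {- \<tau>..} x" and x0: "\<And>\<theta>. \<theta> \<in> {- \<tau>..0} \<Longrightarrow> x \<theta> = \<phi> \<theta>"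
    and xd: "\<And>t. t \<ge> 0 \<Longrightarrow> (x has_vector_derivative F (x t, x (t - \<tau>))) (at t within {0..})"
    by (auto simp: dde_solution_def atLeast_def)
  have x_hist: "norm (x t) < R" if "t \<in> {- \<tau>..0}" for t
    using x0[OF that] norm_bounded[of \<phi> t] \<phi> by simp
  \<comment> \<open>At time \<open>t\<close> the equation sees only \<open>x t\<close> and
    \<open>x (t - \<tau>)\<close>. The delayed value belongs either to the history, bounded by
    \<open>norm \<phi> < R\<close>, or to an earlier time in the interval, so both lie where
    \<open>F\<close> and \<open>f\<close> agree.\<close>
  have sol: "dde_solution f \<tau> \<phi> x T"
    if T: "0 < T" and lt: "\<And>t. 0 \<le> t \<Longrightarrow> ereal t < T \<Longrightarrow> norm (x t) < R" for T
    unfolding dde_solution_def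
  proof (intro conjI ballI allI impI T)
    show "continuous_on {t. - \<tau> \<le> t \<and> ereal t < T} x"
      using xc by (rule continuous_on_subset) auto
    fix t :: real assume t: "0 \<le> t" "ereal t < T"
    have "ereal (t - \<tau>) < T"
      using t \<tau> by (metis diff_less_eq ereal_less_eq(3) less_add_same_cancel1 less_le not_less order_trans)
    then have "norm (x (t - \<tau>)) < R"
      using lt[of "t - \<tau>"] x_hist[of "t - \<tau>"] t by (cases "t - \<tau> \<ge> 0") auto
    with lt[OF t] have "F (x t, x (t - \<tau>)) = f (x t, x (t - \<tau>))"
      by (simp add: F_def c_id)
    with xd[OF t(1)] show "(x has_vector_derivative f (x t, x (t - \<tau>))) (at t within {0..})"
      by simp
  qed (use x0 in auto)
  have lt: "norm (x t) < R" if "0 \<le> t" for t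
  proof (rule ccontr)
    assume "\<not> norm (x t) < R"
    \<comment> \<open>The minimum \<open>T\<close> of this compact set is the first exit time; it is
      positive because the history lies strictly inside the ball.\<close>
    define S where "S = {0..t} \<inter> (\<lambda>s. norm (x s)) -` {R..}"
    have nc: "continuous_on {0..b} (\<lambda>s. norm (x s))" for b
      using \<tau> by (intro continuous_intros continuous_on_subset[OF xc]) auto
    have "closed S"
      unfolding S_def by (intro continuous_closed_preimage nc) auto
    then have "compact S"
      by (metis S_def bounded_Int bounded_closed_interval compact_eq_bounded_closed)
    moreover have "S \<noteq> {}"
      using that \<open>\<not> norm (x t) < R\<close> by (auto simp: S_def)
    ultimately obtain T where T: "T \<in> S" "\<And>s. s \<in> S \<Longrightarrow> T \<le> s"
      by (metis compact_attains_inf)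
    have T0: "T > 0"
      using T(1) x_hist[of 0] \<tau> by (cases "T = 0") (auto simp: S_def)
    have "norm (x s) < R" if "0 \<le> s" "s < T" for s
      using T(2)[of s] that T(1) by (force simp: S_def)
    then have "dde_solution f \<tau> \<phi> x (ereal T)"
      using T0 by (intro sol) auto
    then have le: "norm (x s) \<le> r" if "s \<in> {0<..<T}" for s
      using that by (intro r(2)) auto
    have "norm (x T) \<le> r"
    proof (rule continuous_le_on_closure[of "{0<..<T}" "\<lambda>s. norm (x s)"])
      show "continuous_on (closure {0<..<T}) (\<lambda>s. norm (x s))"
        using nc[of T] T0 by simp
    qed (use T0 le in auto)
    then show False using T(1) r(1) by (auto simp: S_def)
  qed
  show ?thesis
    using sol[of \<infinity>] lt by auto
qed

section \<open>Scalar decay estimates\<close>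

text \<open>For \<open>w > 0\<close> the right-hand side is
  \<open>(w powr (- k) + k * c * t) powr (- 1 / k)\<close>, which increases with \<open>w\<close>;
  hence an upper bound \<open>w\<close> of the initial value suffices. The case
  \<open>v t = 0\<close> is separated because the negative power needs positive values.\<close>

lemma superlinear_decay_bound:
  fixes v :: "real \<Rightarrow> real"
  assumes c: "c > 0" and k: "k > 0" and t: "0 \<le> t" and w: "v 0 \<le> w"
    and nonneg: "\<And>s. s \<in> {0..t} \<Longrightarrow> v s \<ge> 0"
    and deriv: "\<And>s. s \<in> {0..t} \<Longrightarrow>
      \<exists>D. (v has_real_derivative D) (at s within {0..}) \<and> D + c * v s powr (1 + k) \<le> 0"
  shows "v t \<le> w / (1 + k * c * w powr k * t) powr (1 / k)"
proof (cases "v t = 0")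
  case True
  then show ?thesis using w nonneg[of 0] t by simp
next
  case False
  have cont: "continuous_on {0..t} v"
    unfolding continuous_on_eq_continuous_within
  proof
    fix s assume "s \<in> {0..t}"
    with deriv obtain D where "(v has_real_derivative D) (at s within {0..})" by blast
    then show "continuous (at s within {0..t}) v"
      using DERIV_continuous continuous_within_subset by (metis atLeastAtMost_iff atLeast_iff subsetI)
  qed
  have deriv': "\<exists>D. (v has_real_derivative D) (at s) \<and> D + c * v s powr (1 + k) \<le> 0"
    if "0 < s" "s < t" for s
  proof -
    have "at s within {0..} = at s"
      using that by (intro at_within_interior) simp
    then show ?thesis using deriv[of s] that by simp
  qed
  \<comment> \<open>As \<open>v\<close> is nonincreasing, a nonzero final value forces positivity on
    the whole interval.\<close>
  have pos: "v s > 0" if "s \<in> {0..t}" for s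
  proof -
    have "v t \<le> v s"
    proof (rule DERIV_nonpos_imp_decreasing_open[of s t v])
      fix r assume "s < r" "r < t"
      with that obtain D where D: "(v has_real_derivative D) (at r)" "D + c * v r powr (1 + k) \<le> 0"
        using deriv'[of r] by auto
      moreover have "c * v r powr (1 + k) \<ge> 0" using c by simp
      ultimately show "\<exists>y. (v has_real_derivative y) (at r) \<and> y \<le> 0" by force
    qed (use that in \<open>auto intro: continuous_on_subset[OF cont]\<close>)
    with False nonneg[of t] t show ?thesis by force
  qed
  have w0: "w > 0" using pos[of 0] t w by simp
  have "v 0 powr (- k) - k * c * 0 \<le> v t powr (- k) - k * c * t"
  proof (rule DERIV_nonneg_imp_increasing_open[OF t, of "\<lambda>s. v s powr (- k) - k * c * s"])
    fix s assume s: "0 < s" "s < t"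
    with deriv' obtain D where D: "(v has_real_derivative D) (at s)" "D + c * v s powr (1 + k) \<le> 0"
      by blast
    have vs: "v s > 0" using pos s by simp
    \<comment> \<open>The exponents \<open>- k - 1\<close> and \<open>1 + k\<close> cancel, so the
      differential inequality bounds the derivative of \<open>v powr (- k)\<close> below by the
      constant \<open>k * c\<close>.\<close>
    have "c = (v s powr (- k - 1) * v s powr (1 + k)) * c"
      using vs by (simp flip: powr_add)
    also have "\<dots> \<le> v s powr (- k - 1) * (- D)"
      using mult_left_mono[of "c * v s powr (1 + k)" "- D" "v s powr (- k - 1)"] D(2)
      by (simp add: mult_ac)
    finally have "k * c \<le> k * (v s powr (- k - 1) * (- D))"
      using k by (intro mult_left_mono) auto
    then have "- k * v s powr (- k - 1) * D - k * c \<ge> 0" by simp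
    moreover have "((\<lambda>s. v s powr (- k) - k * c * s) has_real_derivative
        - k * v s powr (- k - 1) * D - k * c) (at s)"
      using DERIV_fun_powr[OF D(1) vs, of "- k"]
      by (intro DERIV_diff) (auto intro!: derivative_eq_intros)
    ultimately show "\<exists>y. ((\<lambda>s. v s powr (- k) - k * c * s) has_real_derivative y) (at s) \<and> 0 \<le> y"
      by blast
  next
    show "continuous_on {0..t} (\<lambda>s. v s powr (- k) - k * c * s)"
      using pos by (intro continuous_intros cont) force
  qed
  moreover have "w powr (- k) \<le> v 0 powr (- k)"
    using k w pos[of 0] t by (intro powr_mono2') auto
  ultimately have le: "w powr (- k) + k * c * t \<le> v t powr (- k)"
    by simp
  define q where "q = 1 + k * c * w powr k * t"
  have "k * c * w powr k * t \<ge> 0" using k c t by simp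
  then have q: "q > 0" unfolding q_def by linarith
  \<comment> \<open>The claimed bound is compared with \<open>v t\<close> after taking the power
    \<open>- k\<close>, which reverses strict inequalities between positive numbers.\<close>
  have "(w / q powr (1 / k)) powr (- k) = w powr (- k) * q"
    using q k by (simp add: powr_divide powr_powr powr_minus field_simps)
  also have "\<dots> = w powr (- k) + k * c * t"
    using w0 by (simp add: q_def powr_minus field_simps)
  finally have *: "(w / q powr (1 / k)) powr (- k) \<le> v t powr (- k)"
    using le by simp
  show ?thesis
  proof (rule ccontr)
    assume "\<not> ?thesis"
    then have "w / q powr (1 / k) < v t" by (simp add: q_def)
    then have "v t powr (- k) < (w / q powr (1 / k)) powr (- k)"
      using k w0 q by (intro powr_less_mono2_neg) auto
    with * show False by simp
  qed
qed

lemma powr_le_iff_le_powr: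
  fixes x y r :: real
  assumes "r > 0" "x \<ge> 0" "y \<ge> 0"
  shows "x powr r \<le> y \<longleftrightarrow> x \<le> y powr (1 / r)"
proof
  assume "x powr r \<le> y"
  then have "(x powr r) powr (1 / r) \<le> y powr (1 / r)"
    using assms by (intro powr_mono2) auto
  then show "x \<le> y powr (1 / r)" using assms by (simp add: powr_powr)
next
  assume "x \<le> y powr (1 / r)"
  then have "x powr r \<le> (y powr (1 / r)) powr r"
    using assms by (intro powr_mono2) auto
  then show "x powr r \<le> y" using assms by (simp add: powr_powr)
qed

text \<open>Solving the assumption for \<open>y\<close> gives the powers
  \<open>r\<^sub>2 / r\<^sub>1\<close> and \<open>r\<^sub>2 * k\<close> of \<open>s\<close> and the
  decay exponent \<open>1 / (k * r\<^sub>1)\<close>. The target form couples the last two through a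
  single \<open>\<kappa>\<close> and demands \<open>e \<le> 1\<close>; the mismatch goes into
  \<open>M\<close>, using \<open>s < \<sigma>\<close>.\<close>

lemma rational_rate_bound:
  fixes lam\<^sub>1 lam\<^sub>2 r\<^sub>1 r\<^sub>2 k c \<sigma> :: real
  assumes pos: "lam\<^sub>1 > 0" "lam\<^sub>2 > 0" "r\<^sub>1 > 0" "r\<^sub>2 > 0" "k > 0" "c > 0" "\<sigma> > 0"
  obtains M \<kappa> e :: real where "M > 0" "\<kappa> > 0" "e > 0" "e \<le> 1"
    and "\<And>s t y. \<lbrakk>0 \<le> s; s < \<sigma>; 0 \<le> t; 0 \<le> y; lam\<^sub>1 * y powr r\<^sub>1
        \<le> lam\<^sub>2 * s powr r\<^sub>2 / (1 + k * c * (lam\<^sub>2 * s powr r\<^sub>2) powr k * t) powr (1 / k)\<rbrakk>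
      \<Longrightarrow> y \<le> M * s powr e / (1 + s powr \<kappa> * t) powr (1 / \<kappa>)"
proof -
  \<comment> \<open>\<open>\<kappa> \<ge> k * r\<^sub>1\<close> because the decay exponent is \<open>1 / (k * r\<^sub>1)\<close>, and \<open>\<kappa> \<ge> r\<^sub>2 * k\<close> so that \<open>s powr \<kappa>\<close> is
    dominated by \<open>s powr (r\<^sub>2 * k)\<close> on \<open>s < \<sigma>\<close>.\<close>
  define \<kappa> where "\<kappa> = k * max r\<^sub>1 r\<^sub>2"
  define e where "e = min 1 (r\<^sub>2 / r\<^sub>1)"
  define a where "a = k * c * lam\<^sub>2 powr k"
  \<comment> \<open>Chosen so that \<open>b * (1 + s powr \<kappa> * t) \<le> 1 + a * s powr
    (r\<^sub>2 * k) * t\<close>: the cap 1 serves the constant term, the other entry the term in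
    \<open>t\<close>.\<close>
  define b where "b = min 1 (a * \<sigma> powr (r\<^sub>2 * k - \<kappa>))"
  define p where "p = 1 / (k * r\<^sub>1)"
  \<comment> \<open>The factors come from solving for \<open>y\<close>, from lowering the power of
    \<open>s\<close> to \<open>e\<close>, and from replacing the denominator.\<close>
  define M where "M = (lam\<^sub>2 / lam\<^sub>1) powr (1 / r\<^sub>1) * \<sigma> powr (r\<^sub>2 / r\<^sub>1 - e) / b powr p"
  have \<kappa>: "\<kappa> > 0" "k * r\<^sub>1 \<le> \<kappa>" "r\<^sub>2 * k \<le> \<kappa>"
    using pos by (auto simp: \<kappa>_def max_def mult.commute)
  have e: "e > 0" "e \<le> 1" "e \<le> r\<^sub>2 / r\<^sub>1" using pos by (auto simp: e_def)
  have a: "a > 0" using pos by (simp add: a_def)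
  then have b: "b > 0" "b \<le> 1" "b \<le> a * \<sigma> powr (r\<^sub>2 * k - \<kappa>)"
    using pos by (auto simp: b_def)
  have p: "p > 0" "1 / \<kappa> \<le> p"
    using pos \<kappa> by (auto simp: p_def intro!: divide_left_mono)
  show thesis
  proof (rule that[of M \<kappa> e])
    show "M > 0" using pos b by (simp add: M_def)
    fix s t y :: real
    assume s: "0 \<le> s" "s < \<sigma>" and t: "0 \<le> t" and y: "0 \<le> y"
      and le: "lam\<^sub>1 * y powr r\<^sub>1
        \<le> lam\<^sub>2 * s powr r\<^sub>2 / (1 + k * c * (lam\<^sub>2 * s powr r\<^sub>2) powr k * t) powr (1 / k)"
    define q where "q = 1 + a * s powr (r\<^sub>2 * k) * t"
    define q' where "q' = 1 + s powr \<kappa> * t"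
    have q': "q' \<ge> 1" using t by (simp add: q'_def)
    have "b * s powr \<kappa> \<le> a * \<sigma> powr (r\<^sub>2 * k - \<kappa>) * s powr \<kappa>"
      using b by (intro mult_right_mono) auto
    also have "\<dots> \<le> a * s powr (r\<^sub>2 * k)"
    proof (cases "s = 0")
      case False
      then have "\<sigma> powr (r\<^sub>2 * k - \<kappa>) \<le> s powr (r\<^sub>2 * k - \<kappa>)"
        using s \<kappa> by (intro powr_mono2') auto
      then have "\<sigma> powr (r\<^sub>2 * k - \<kappa>) * s powr \<kappa> \<le> s powr (r\<^sub>2 * k - \<kappa>) * s powr \<kappa>"
        by (intro mult_right_mono) auto
      also have "\<dots> = s powr (r\<^sub>2 * k)" by (simp flip: powr_add)
      finally show ?thesis using a by (simp add: mult.assoc)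
    qed simp
    finally have "b * s powr \<kappa> * t \<le> a * s powr (r\<^sub>2 * k) * t"
      using t by (intro mult_right_mono)
    then have bq: "b * q' \<le> q" using b by (simp add: q_def q'_def algebra_simps)
    then have q: "q > 0" using b q' by (smt (verit) mult_pos_pos)
    have "b powr p * q' powr (1 / \<kappa>) \<le> b powr p * q' powr p"
      using p q' by (intro mult_left_mono powr_mono) auto
    also have "\<dots> = (b * q') powr p" by (simp add: powr_mult)
    also have "\<dots> \<le> q powr p"
      using bq b q' p by (intro powr_mono2) auto
    finally have q_le: "b powr p * q' powr (1 / \<kappa>) \<le> q powr p" .
    have s_le: "s powr (r\<^sub>2 / r\<^sub>1) \<le> \<sigma> powr (r\<^sub>2 / r\<^sub>1 - e) * s powr e"
    proof -
      \<comment> \<open>This covers \<open>s = 0\<close> as well, since \<open>0 powr x = 0\<close>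
        for every \<open>x\<close>, including \<open>x = 0\<close>.\<close>
      have "s powr (r\<^sub>2 / r\<^sub>1) = s powr (r\<^sub>2 / r\<^sub>1 - e) * s powr e"
        by (simp flip: powr_add)
      also have "\<dots> \<le> \<sigma> powr (r\<^sub>2 / r\<^sub>1 - e) * s powr e"
        using s e by (intro mult_right_mono powr_mono2) auto
      finally show ?thesis .
    qed
    have "k * c * (lam\<^sub>2 * s powr r\<^sub>2) powr k = a * s powr (r\<^sub>2 * k)"
      by (simp add: a_def powr_mult powr_powr)
    with le have "lam\<^sub>1 * y powr r\<^sub>1 \<le> lam\<^sub>2 * s powr r\<^sub>2 / q powr (1 / k)"
      by (simp add: q_def)
    then have "(lam\<^sub>1 * y powr r\<^sub>1) / lam\<^sub>1 \<le> lam\<^sub>2 * s powr r\<^sub>2 / q powr (1 / k) / lam\<^sub>1"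
      using pos by (intro divide_right_mono) auto
    then have "y powr r\<^sub>1 \<le> lam\<^sub>2 / lam\<^sub>1 * s powr r\<^sub>2 / q powr (1 / k)"
      using pos by (simp add: mult_ac)
    then have "y \<le> (lam\<^sub>2 / lam\<^sub>1 * s powr r\<^sub>2 / q powr (1 / k)) powr (1 / r\<^sub>1)"
      using pos y by (subst (asm) powr_le_iff_le_powr) auto
    also have "\<dots> = (lam\<^sub>2 / lam\<^sub>1) powr (1 / r\<^sub>1) * s powr (r\<^sub>2 / r\<^sub>1) / q powr p"
      by (simp add: powr_mult powr_divide powr_powr p_def)
    also have "\<dots> \<le> (lam\<^sub>2 / lam\<^sub>1) powr (1 / r\<^sub>1) * (\<sigma> powr (r\<^sub>2 / r\<^sub>1 - e) * s powr e)
        / (b powr p * q' powr (1 / \<kappa>))"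
      using b q' by (intro frac_le mult_left_mono s_le q_le) auto
    also have "\<dots> = M * s powr e / q' powr (1 / \<kappa>)"
      by (simp add: M_def)
    finally show "y \<le> M * s powr e / (1 + s powr \<kappa> * t) powr (1 / \<kappa>)"
      by (simp add: q'_def)
  qed (use \<kappa> e in auto)
qed

section \<open>The functional along solutions\<close>

text \<open>Both functions are constant outside the delay interval, so agreement on it gives
  equality on the whole line.\<close>

lemma segment_zero:
  assumes "\<phi> \<in> phase_space \<tau>" "\<tau> > 0" "dde_solution f \<tau> \<phi> x T"
  shows "segment \<tau> x 0 = \<phi>"
proof (rule bcontfun_eqI)
  fix \<theta>
  have "{- \<tau>..0} \<subseteq> {t. - \<tau> \<le> t \<and> ereal t < T}"
    using assms(3) le_less_trans[of "ereal _" 0 T] by (auto simp: dde_solution_def)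
  then have "continuous_on {0 - \<tau>..0} x"
    using assms(3) by (auto simp: dde_solution_def intro: continuous_on_subset)
  moreover have "clamp (- \<tau>) 0 \<theta> \<in> cbox (- \<tau>) 0"
    using assms(2) by (intro clamp_in_interval) auto
  ultimately have "segment \<tau> x 0 \<theta> = \<phi> (clamp (- \<tau>) 0 \<theta>)"
    using assms(3) by (simp add: segment_clamp dde_solution_def)
  also have "\<dots> = \<phi> \<theta>"
    using assms(1) by (simp add: phase_space_def flip: spec)
  finally show "segment \<tau> x 0 \<theta> = \<phi> \<theta>" .
qed

text \<open>Substituting \<open>s = t + h\<close> turns the constraint \<open>h \<ge> - t\<close>
  into \<open>s \<ge> 0\<close>.\<close>

lemma has_derivative_along_imp_has_real_derivative:
  assumes "has_derivative_along V \<tau> x t D"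
  shows "((\<lambda>t. V (segment \<tau> x t)) has_real_derivative D) (at t within {0..})"
  unfolding has_field_derivative_iff Lim_within
proof (intro allI impI)
  fix \<epsilon> :: real assume "\<epsilon> > 0"
  with assms obtain d where d: "d > 0" "\<And>h. h \<in> {- t..} \<Longrightarrow> 0 < dist h 0 \<and> dist h 0 < d \<Longrightarrow>
      dist (1 / h * (V (segment \<tau> x (t + h)) - V (segment \<tau> x t))) D < \<epsilon>"
    unfolding has_derivative_along_def Lim_within by meson
  show "\<exists>d>0. \<forall>s\<in>{0..}. 0 < dist s t \<and> dist s t < d \<longrightarrow>
      dist ((V (segment \<tau> x s) - V (segment \<tau> x t)) / (s - t)) D < \<epsilon>"
    using d(1) d(2)[of "s - t" for s] by (intro exI[of _ d]) (auto simp: dist_norm)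
qed

section \<open>Stability and the rational rate\<close>

theorem theorem1:
  fixes f :: "(real ^ 'n) \<times> (real ^ 'n) \<Rightarrow> real ^ 'n"
    and V :: "(real \<Rightarrow>\<^sub>C (real ^ 'n)) \<Rightarrow> real"
    and \<tau> lam\<^sub>1 lam\<^sub>2 lam\<^sub>3 r\<^sub>1 r\<^sub>2 k :: real
  assumes "\<tau> > 0"
    and "local_lipschitz (UNIV :: real set) UNIV (\<lambda>_. f)"
    and "f (0, 0) = 0"
    and "lam\<^sub>1 > 0" "lam\<^sub>2 > 0" "lam\<^sub>3 > 0" "r\<^sub>1 > 0" "r\<^sub>2 > 0" "k > 0"
    and "\<And>\<phi>. \<phi> \<in> phase_space \<tau> \<Longrightarrow> V \<phi> \<ge> 0"
    and "continuously_differentiable \<tau> V"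
    and "\<And>\<phi> x T t. \<lbrakk>\<phi> \<in> phase_space \<tau>; dde_solution f \<tau> \<phi> x T; 0 \<le> t; ereal t < T\<rbrakk> \<Longrightarrow>
           lam\<^sub>1 * norm (x t) powr r\<^sub>1 \<le> V (segment \<tau> x t) \<and>
           V (segment \<tau> x t) \<le> lam\<^sub>2 * norm (segment \<tau> x t) powr r\<^sub>2"
    and "\<And>\<phi> x T t. \<lbrakk>\<phi> \<in> phase_space \<tau>; dde_solution f \<tau> \<phi> x T; 0 \<le> t; ereal t < T\<rbrakk> \<Longrightarrow>
           \<exists>D. has_derivative_along V \<tau> x t D \<and> D + lam\<^sub>3 * V (segment \<tau> x t) powr (1 + k) \<le> 0"
  shows "globally_rationally_stable f \<tau>"
proof -
  note lam_pos = assms(4-6) and r_pos = assms(7,8) and k = assms(9)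
  note V_bounds = assms(12) and V_deriv = assms(13)
  \<comment> \<open>The lower bound on \<open>V\<close> is used at time \<open>t\<close>, the upper
    bound only at time 0, where the segment is \<open>\<phi>\<close>.\<close>
  have decay: "lam\<^sub>1 * norm (x t) powr r\<^sub>1 \<le> lam\<^sub>2 * norm \<phi> powr r\<^sub>2 /
      (1 + k * lam\<^sub>3 * (lam\<^sub>2 * norm \<phi> powr r\<^sub>2) powr k * t) powr (1 / k)"
    if \<phi>: "\<phi> \<in> phase_space \<tau>" and sol: "dde_solution f \<tau> \<phi> x T" and t: "0 \<le> t" "ereal t < T"
    for \<phi> x T t
  proof -
    have T: "ereal s < T" if "s \<le> t" for s
      using that t(2) by (metis ereal_less_eq(3) le_less_trans)
    have "lam\<^sub>1 * norm (x t) powr r\<^sub>1 \<le> V (segment \<tau> x t)"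
      using V_bounds[OF \<phi> sol t] by simp
    also have "\<dots> \<le> lam\<^sub>2 * norm \<phi> powr r\<^sub>2 /
        (1 + k * lam\<^sub>3 * (lam\<^sub>2 * norm \<phi> powr r\<^sub>2) powr k * t) powr (1 / k)"
    proof (rule superlinear_decay_bound[OF lam_pos(3) k t(1)])
      show "V (segment \<tau> x 0) \<le> lam\<^sub>2 * norm \<phi> powr r\<^sub>2"
        using V_bounds[OF \<phi> sol, of 0] T[of 0] t(1) segment_zero[OF \<phi> assms(1) sol] by simp
      fix s assume s: "s \<in> {0..t}"
      have "0 \<le> lam\<^sub>1 * norm (x s) powr r\<^sub>1" using lam_pos by simp
      then show "V (segment \<tau> x s) \<ge> 0"
        using V_bounds[OF \<phi> sol, of s] T[of s] s by simp
      show "\<exists>D. ((\<lambda>t. V (segment \<tau> x t)) has_real_derivative D) (at s within {0..}) \<and>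
          D + lam\<^sub>3 * V (segment \<tau> x s) powr (1 + k) \<le> 0"
        using V_deriv[OF \<phi> sol, of s] T[of s] s has_derivative_along_imp_has_real_derivative
        by fastforce
    qed
    finally show ?thesis .
  qed
  \<comment> \<open>Dropping the denominator, which is at least 1, leaves a bound uniform in time;
    it yields both global existence and stability.\<close>
  have bound: "lam\<^sub>1 * norm (x t) powr r\<^sub>1 \<le> lam\<^sub>2 * norm \<phi> powr r\<^sub>2"
    if "\<phi> \<in> phase_space \<tau>" "dde_solution f \<tau> \<phi> x T" "0 \<le> t" "ereal t < T" for \<phi> x T t
  proof -
    have "(1 + k * lam\<^sub>3 * (lam\<^sub>2 * norm \<phi> powr r\<^sub>2) powr k * t) powr (1 / k) \<ge> 1"
      using k lam_pos that(3) by (intro ge_one_powr_ge_zero) auto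
    then have "lam\<^sub>2 * norm \<phi> powr r\<^sub>2 /
        (1 + k * lam\<^sub>3 * (lam\<^sub>2 * norm \<phi> powr r\<^sub>2) powr k * t) powr (1 / k) \<le> lam\<^sub>2 * norm \<phi> powr r\<^sub>2 / 1"
      using lam_pos by (intro divide_left_mono) auto
    with decay[OF that] show ?thesis by simp
  qed
  have global: "\<exists>x. dde_solution f \<tau> \<phi> x \<infinity>" if \<phi>: "\<phi> \<in> phase_space \<tau>" for \<phi>
  proof -
    define r where "r = (lam\<^sub>2 * norm \<phi> powr r\<^sub>2 / lam\<^sub>1) powr (1 / r\<^sub>1)"
    show ?thesis
    proof (rule apriori_bound_imp_global_dde_solution[OF assms(1,2)])
      show "norm \<phi> < max (norm \<phi>) r + 1" "r < max (norm \<phi>) r + 1" by auto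
      fix x T t assume "dde_solution f \<tau> \<phi> x T" "0 \<le> t" "ereal t < T"
      from bound[OF \<phi> this] have "norm (x t) powr r\<^sub>1 \<le> lam\<^sub>2 * norm \<phi> powr r\<^sub>2 / lam\<^sub>1"
        using lam_pos by (simp add: pos_le_divide_eq mult.commute)
      then show "norm (x t) \<le> r"
        unfolding r_def using lam_pos r_pos by (subst (asm) powr_le_iff_le_powr) auto
    qed
  qed
  \<comment> \<open>For \<open>\<epsilon> > 0\<close> this is the solution of \<open>lam\<^sub>2 *
    \<delta> powr r\<^sub>2 = lam\<^sub>1 * \<epsilon> powr r\<^sub>1\<close>.\<close>
  define \<delta> where "\<delta> \<epsilon> = (lam\<^sub>1 * \<epsilon> powr r\<^sub>1 / lam\<^sub>2) powr (1 / r\<^sub>2)" for \<epsilon>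
  have stable: "stable_bound f \<tau> \<epsilon> (\<delta> \<epsilon>)" if \<epsilon>: "\<epsilon> > 0" for \<epsilon>
    unfolding stable_bound_def globally_satisfies_def
  proof (intro ballI impI conjI allI global)
    fix \<phi> x and t :: real
    assume \<phi>: "\<phi> \<in> phase_space \<tau>" "norm \<phi> < \<delta> \<epsilon>" and sol: "dde_solution f \<tau> \<phi> x \<infinity>" and t: "0 \<le> t"
    have "norm \<phi> powr r\<^sub>2 < \<delta> \<epsilon> powr r\<^sub>2"
      using \<phi> r_pos by (intro powr_less_mono2) auto
    also have "\<dots> = lam\<^sub>1 * \<epsilon> powr r\<^sub>1 / lam\<^sub>2"
      using lam_pos r_pos by (simp add: \<delta>_def powr_powr)
    finally have "lam\<^sub>2 * norm \<phi> powr r\<^sub>2 < lam\<^sub>1 * \<epsilon> powr r\<^sub>1"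
      using lam_pos by (simp add: pos_less_divide_eq mult.commute)
    then have "lam\<^sub>1 * norm (x t) powr r\<^sub>1 < lam\<^sub>1 * \<epsilon> powr r\<^sub>1"
      using bound[OF \<phi>(1) sol t] by simp
    then have "norm (x t) powr r\<^sub>1 < \<epsilon> powr r\<^sub>1" using lam_pos by simp
    then show "norm (x t) < \<epsilon>"
      using powr_mono2[of r\<^sub>1 \<epsilon> "norm (x t)"] r_pos \<epsilon> by fastforce
  qed
  show ?thesis
    unfolding globally_rationally_stable_def
  proof (intro conjI allI impI)
    show "zero_stable f \<tau>"
      unfolding zero_stable_def
    proof (intro allI impI)
      fix \<epsilon> :: real assume "\<epsilon> > 0"
      moreover have "\<delta> \<epsilon> > 0" if "\<epsilon> > 0" for \<epsilon> using that lam_pos by (simp add: \<delta>_def)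
      ultimately show "\<exists>\<delta>>0. stable_bound f \<tau> \<epsilon> \<delta>" using stable by blast
    qed
  next
    fix \<Delta> :: real
    \<comment> \<open>\<open>\<Delta>\<close> may be negative, while inverting powers needs a
      nonnegative base. The threshold then inverts the formula for \<open>\<delta>\<close>, and the
      maximum with 1 keeps it positive when \<open>D = 0\<close>.\<close>
    define D where "D = max \<Delta> 0"
    define \<epsilon>\<^sub>0 where "\<epsilon>\<^sub>0 = max 1 ((lam\<^sub>2 * D powr r\<^sub>2 / lam\<^sub>1) powr (1 / r\<^sub>1))"
    have "\<Delta> \<le> \<delta> \<epsilon>" if "\<epsilon> \<ge> \<epsilon>\<^sub>0" for \<epsilon>
    proof -
      have \<epsilon>: "\<epsilon> > 0" "(lam\<^sub>2 * D powr r\<^sub>2 / lam\<^sub>1) powr (1 / r\<^sub>1) \<le> \<epsilon>"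
        using that by (auto simp: \<epsilon>\<^sub>0_def)
      then have "lam\<^sub>2 * D powr r\<^sub>2 / lam\<^sub>1 \<le> \<epsilon> powr r\<^sub>1"
        using lam_pos r_pos by (subst (asm) powr_le_iff_le_powr) auto
      then have "D powr r\<^sub>2 \<le> lam\<^sub>1 * \<epsilon> powr r\<^sub>1 / lam\<^sub>2"
        using lam_pos by (simp add: field_simps)
      then have "D \<le> \<delta> \<epsilon>"
        unfolding \<delta>_def using lam_pos r_pos by (subst (asm) powr_le_iff_le_powr) (auto simp: D_def)
      then show ?thesis by (simp add: D_def)
    qed
    moreover have "\<epsilon>\<^sub>0 > 0" by (simp add: \<epsilon>\<^sub>0_def)
    ultimately show "\<exists>\<epsilon>\<^sub>0>0. \<forall>\<epsilon>\<ge>\<epsilon>\<^sub>0. \<exists>\<delta>\<ge>\<Delta>. stable_bound f \<tau> \<epsilon> \<delta>"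
      using stable by (meson less_le_trans)
  next
    fix \<sigma> :: real assume \<sigma>: "\<sigma> > 0"
    obtain M \<kappa> e :: real where M: "M > 0" and \<kappa>: "\<kappa> > 0" and e: "e > 0" "e \<le> 1"
      and rate: "\<And>s t y. \<lbrakk>0 \<le> s; s < \<sigma>; 0 \<le> t; 0 \<le> y; lam\<^sub>1 * y powr r\<^sub>1
          \<le> lam\<^sub>2 * s powr r\<^sub>2 / (1 + k * lam\<^sub>3 * (lam\<^sub>2 * s powr r\<^sub>2) powr k * t) powr (1 / k)\<rbrakk>
        \<Longrightarrow> y \<le> M * s powr e / (1 + s powr \<kappa> * t) powr (1 / \<kappa>)"
      using rational_rate_bound[OF lam_pos(1,2) r_pos k lam_pos(3) \<sigma>] by blast
    show "\<exists>M>0. \<exists>\<kappa>>0. \<exists>e>0. e \<le> 1 \<and>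
        (\<forall>\<phi>\<in>phase_space \<tau>. norm \<phi> < \<sigma> \<longrightarrow>
           globally_satisfies f \<tau> \<phi>
             (\<lambda>t y. norm y \<le> M * norm \<phi> powr e / (1 + norm \<phi> powr \<kappa> * t) powr (1 / \<kappa>)))"
    proof (rule exI[of _ M], intro conjI M, rule exI[of _ \<kappa>], intro conjI \<kappa>,
        rule exI[of _ e], intro conjI e ballI impI)
      fix \<phi> :: "real \<Rightarrow>\<^sub>C (real ^ 'n)"
      assume \<phi>: "\<phi> \<in> phase_space \<tau>" "norm \<phi> < \<sigma>"
      show "globally_satisfies f \<tau> \<phi>
          (\<lambda>t y. norm y \<le> M * norm \<phi> powr e / (1 + norm \<phi> powr \<kappa> * t) powr (1 / \<kappa>))"
        unfolding globally_satisfies_def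
        using global[OF \<phi>(1)] decay[OF \<phi>(1)] \<phi>(2) by (auto intro!: rate)
    qed
  qed
qed

end
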